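(* Assume $\mathfrak b=\mathfrak s=\mathfrak c$. Then completely separable MAD families which are strongly $(\aleph_0,<\mathfrak c)$-separated exist generically; that is, every almost disjoint family (over $\omega$) of size less than $\mathfrak c$ can be extended to a MAD family (over $\omega$) which is completely separable and strongly $(\aleph_0,<\mathfrak c)$-separated.
   Context: An almost disjoint family (over $\omega$) is an infinite collection $\mathcal A$ of infinite subsets of $\omega$ such that $a\cap b$ is finite for all distinct $a,b\in\mathcal A$. A MAD family is an almost disjoint family not properly contained in any other almost disjoint family. $x\subseteq^* y$ means $x\setminus y$ is finite; $x=^*\emptyset$ means $x$ is finite. A set $X\subseteq\omega$ is a partitioner for $\mathcal A$ if for each $a\in\mathcal A$, $a\subseteq^* X$ or $a\cap X=^*\emptyset$. For $\mathcal B,\mathcal C\subseteq\mathcal A$, a partitioner $X$ for $\mathcal A$ is a partitioner for $\mathcal B$ and $\mathcal C$ if $b\subseteq^* X$ for all $b\in\mathcal B$ and $c\cap X=^*\emptyset$ for all $c\in\mathcal C$. The family $\mathcal A$ is strongly $(\aleph_0,<\mathfrak c)$-separated iff for every two disjoint $\mathcal B,\mathcal C\subseteq\mathcal A$ with $\mathcal B$ countable and $|\mathcal C|<\mathfrak c$, there exists a partitioner $X\subseteq\omega$ (for $\mathcal A$) for $\mathcal B$ and $\mathcal C$. Let $\mathcal J^+(\mathcal A)=\{X\subseteq\omega: |\{a\in\mathcal A:|a\cap X|=\omega\}|\geq\omega\}$. An almost disjoint family $\mathcal A$ is completely separable iff for every $A\in\mathcal J^+(\mathcal A)$ there exists $a\in\mathcal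 A$ with $a\subseteq A$. MAD families with a property $P$ exist generically iff all almost disjoint families of size less than $\mathfrak c$ can be extended to a MAD family with property $P$. $\mathfrak b$ is the least cardinality of a family in $\omega^\omega$ that is unbounded with respect to $<^*$ ($f<^*g$ iff $\{n:f(n)\ge g(n)\}$ is finite); $\mathfrak s$ is the least size of a splitting family, i.e. of $\mathcal S\subseteq\mathcal P(\omega)$ such that for every $X\in[\omega]^\omega$ there is $A\in\mathcal S$ with both $X\setminus A$ and $X\cap A$ infinite; $\mathfrak c=2^{\aleph_0}$. *)

theory Defs
  imports "HOL-Library.Countable_Set" "HOL-Library.Infinite_Set"
begin

unbundle cardinal_syntax

subsection \<open>Almost disjoint families over the natural numbers\<close>

definition almost_subset :: "nat set \<Rightarrow> nat set \<Rightarrow> bool"  (infix "\<subseteq>\<^sup>*" 50) where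
  "x \<subseteq>\<^sup>* y \<longleftrightarrow> finite (x - y)"

definition almost_disjoint_family :: "nat set set \<Rightarrow> bool" where
  "almost_disjoint_family \<A> \<longleftrightarrow>
     infinite \<A> \<and> (\<forall>a\<in>\<A>. infinite a) \<and>
     (\<forall>a\<in>\<A>. \<forall>b\<in>\<A>. a \<noteq> b \<longrightarrow> finite (a \<inter> b))"

definition mad_family :: "nat set set \<Rightarrow> bool" where
  "mad_family \<A> \<longleftrightarrow>
     almost_disjoint_family \<A> \<and> \<not> (\<exists>\<B>. almost_disjoint_family \<B> \<and> \<A> \<subset> \<B>)"

definition partitioner :: "nat set set \<Rightarrow> nat set \<Rightarrow> bool" where
  "partitioner \<A> X \<longleftrightarrow> (\<forall>a\<in>\<A>. a \<subseteq>\<^sup>* X \<or> finite (a \<inter> X))"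

definition partitioner_for ::
    "nat set set \<Rightarrow> nat set set \<Rightarrow> nat set set \<Rightarrow> nat set \<Rightarrow> bool" where
  "partitioner_for \<A> \<B> \<C> X \<longleftrightarrow>
     partitioner \<A> X \<and> (\<forall>b\<in>\<B>. b \<subseteq>\<^sup>* X) \<and> (\<forall>c\<in>\<C>. finite (c \<inter> X))"

abbreviation continuum :: "(nat \<Rightarrow> bool) rel" where
  "continuum \<equiv> ctwo ^c natLeq"

definition strongly_separated :: "nat set set \<Rightarrow> bool" where
  "strongly_separated \<A> \<longleftrightarrow>
     (\<forall>\<B> \<C>. \<B> \<subseteq> \<A> \<and> \<C> \<subseteq> \<A> \<and> \<B> \<inter> \<C> = {} \<and> countable \<B> \<and> |\<C>| <o continuum
        \<longrightarrow> (\<exists>X. partitioner_for \<A> \<B> \<C> X))"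

definition J_plus :: "nat set set \<Rightarrow> nat set set" where
  "J_plus \<A> = {X. infinite {a \<in> \<A>. infinite (a \<inter> X)}}"

definition completely_separable :: "nat set set \<Rightarrow> bool" where
  "completely_separable \<A> \<longleftrightarrow> (\<forall>X \<in> J_plus \<A>. \<exists>a\<in>\<A>. a \<subseteq> X)"

definition mad_exist_generically :: "(nat set set \<Rightarrow> bool) \<Rightarrow> bool" where
  "mad_exist_generically P \<longleftrightarrow>
     (\<forall>\<A>. almost_disjoint_family \<A> \<and> |\<A>| <o continuum
        \<longrightarrow> (\<exists>\<M>. mad_family \<M> \<and> \<A> \<subseteq> \<M> \<and> P \<M>))"

subsection \<open>Cardinal characteristics\<close>

text \<open>
  The least cardinality of a set satisfying \<open>P\<close>, as the cardinal of a chosen witness of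
  least cardinality; meaningful only if some set satisfies \<open>P\<close>.
\<close>

definition least_card :: "('a set \<Rightarrow> bool) \<Rightarrow> 'a rel" where
  "least_card P = |SOME A. P A \<and> (\<forall>B. P B \<longrightarrow> |A| \<le>o |B| )|"

lemma least_card:
  fixes P :: "'a set \<Rightarrow> bool"
  assumes "P A0"
  shows "\<exists>A. P A \<and> least_card P = |A|" and "P B \<Longrightarrow> least_card P \<le>o |B|"
proof -
  have "\<exists>r \<in> card_of ` {A. P A}. \<forall>r' \<in> card_of ` {A. P A}. r \<le>o r'"
    using assms by (intro exists_minim_Card_order) (auto simp: card_of_Card_order)
  then have ex: "\<exists>A. P A \<and> (\<forall>B. P B \<longrightarrow> |A| \<le>o |B| )"
    by auto
  show "\<exists>A. P A \<and> least_card P = |A|"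
    unfolding least_card_def using someI_ex[OF ex] by blast
  show "least_card P \<le>o |B|" if "P B"
    unfolding least_card_def using someI_ex[OF ex] that by blast
qed

definition eventually_less :: "(nat \<Rightarrow> nat) \<Rightarrow> (nat \<Rightarrow> nat) \<Rightarrow> bool"  (infix "<\<^sup>*" 50) where
  "f <\<^sup>* g \<longleftrightarrow> finite {n. f n \<ge> g n}"

definition unbounded_family :: "(nat \<Rightarrow> nat) set \<Rightarrow> bool" where
  "unbounded_family F \<longleftrightarrow> \<not> (\<exists>g. \<forall>f\<in>F. f <\<^sup>* g)"

definition splitting_family :: "nat set set \<Rightarrow> bool" where
  "splitting_family \<S> \<longleftrightarrow>
     (\<forall>X. infinite X \<longrightarrow> (\<exists>A\<in>\<S>. infinite (X - A) \<and> infinite (X \<inter> A)))"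

definition bounding_number :: "(nat \<Rightarrow> nat) rel" where
  "bounding_number = least_card unbounded_family"

definition splitting_number :: "nat set rel" where
  "splitting_number = least_card splitting_family"

lemma unbounded_family_UNIV: "unbounded_family UNIV"
  unfolding unbounded_family_def eventually_less_def
  by (metis UNIV_I Collect_cong UNIV_def infinite_UNIV_nat order_refl)

lemma splitting_family_UNIV: "splitting_family UNIV"
  unfolding splitting_family_def
proof (intro allI impI)
  fix X :: "nat set"
  assume "infinite X"
  then obtain A B where "A \<subseteq> X" "B \<subseteq> X" "infinite A" "infinite B" "A \<inter> B = {}"
    using infinite_split by metis
  moreover from this have "B \<subseteq> X - A" "X \<inter> A = A"
    by auto
  ultimately show "\<exists>A\<in>UNIV. infinite (X - A) \<and> infinite (X \<inter> A)"
    by (metis UNIV_I finite_subset)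
qed

end

theory Submission
  imports Defs "HOL-Library.Nat_Bijection"
begin

text \<open>
  The family is built by a recursion of length \<open>\<cc>\<close>, along the initial well-order of
  \<open>\<P>(\<omega>)\<close>. Stage \<open>i\<close> adds one set \<open>a\<^sub>i\<close> and one promise \<open>X\<^sub>i\<close>, which all later sets have to
  respect: \<open>a\<^sub>j \<subseteq>\<^sup>* X\<^sub>i\<close> or \<open>a\<^sub>j \<inter> X\<^sub>i =\<^sup>* \<emptyset>\<close> for \<open>j \<ge> i\<close>. A countable set
  \<open>\<B>\<close> is given by the bookkeeping, and \<open>X\<^sub>i\<close> separates the part of the current family
  in \<open>\<B>\<close> from all of the rest of it; this is possible since the family has size less than
  \<open>\<bb>\<close>. So only the countable sets \<open>\<B>\<close> are enumerated and not the pairs \<open>(\<B>, \<C>)\<close>, of which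
  there may be more than \<open>\<cc>\<close>: as \<open>\<cc> = \<bb>\<close> is regular, \<open>\<C>\<close> appears before some stage
  that handles \<open>\<B>\<close>. The bookkeeping also gives a set \<open>Y\<close>. If \<open>Y\<close> is in
  \<open>\<J>\<^sup>+\<close>, then \<open>|\<A>\<^sub>i| < \<bb>\<close> gives an infinite subset of \<open>Y\<close> that is almost disjoint from
  the current family, and since there are fewer than \<open>\<ss>\<close> promises, some infinite subset
  \<open>a\<^sub>i\<close> of it is split by none of them.
\<close>

section \<open>Sets of size less than the continuum\<close>

text \<open>Measured against the power set of the naturals, because the stages of the recursion are
  sets of naturals; \<open>small_iff\<close> translates to \<open>continuum\<close>.\<close>

definition small :: "'a set \<Rightarrow> bool" where
  "small S \<longleftrightarrow> |S| <o |UNIV :: nat set set|"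

lemma continuum_ordIso: "|UNIV :: nat set set| =o continuum"
proof -
  have "Func (UNIV :: nat set) (UNIV :: bool set) = UNIV"
    by (auto simp: Func_def)
  then have "continuum = |UNIV :: (nat \<Rightarrow> bool) set|"
    by (simp add: cexp_def ctwo_def Field_card_of Field_natLeq)
  moreover have "bij_betw (\<lambda>S n. n \<in> S) (UNIV :: nat set set) (UNIV :: (nat \<Rightarrow> bool) set)"
    by (rule bij_betw_byWitness[where f' = Collect]) auto
  ultimately show ?thesis
    by (simp add: card_of_ordIsoI)
qed

lemma small_iff: "small S \<longleftrightarrow> |S| <o continuum"
  unfolding small_def
  using ordLess_ordIso_trans[OF _ continuum_ordIso]
    ordLess_ordIso_trans[OF _ ordIso_symmetric[OF continuum_ordIso]] by iprover

lemma small_image: "small S \<Longrightarrow> small (f ` S)"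
  unfolding small_def using card_of_image ordLeq_ordLess_trans by blast

lemma small_subset: "small T \<Longrightarrow> S \<subseteq> T \<Longrightarrow> small S"
  unfolding small_def using card_of_mono1 ordLeq_ordLess_trans by blast

lemma small_countable:
  assumes "countable S"
  shows "small S"
proof -
  have "|UNIV :: nat set| <o |UNIV :: nat set set|"
    using card_of_Pow[of "UNIV :: nat set"] by simp
  moreover have "|S| \<le>o |UNIV :: nat set|"
    using assms unfolding countable_def card_of_ordLeq[symmetric] by blast
  ultimately show ?thesis
    unfolding small_def using ordLeq_ordLess_trans by blast
qed

lemma small_Un: "small S \<Longrightarrow> small T \<Longrightarrow> small (S \<union> T)"
  unfolding small_def
  by (rule card_of_Un_ordLess_infinite) (simp add: infinite_UNIV_char_0 Finite_Set.finite_set)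

lemma not_small_UNIV: "\<not> small (UNIV :: nat set set)"
  unfolding small_def using ordLess_irreflexive by blast

lemma not_small_if_continuum_le: "r =o continuum \<Longrightarrow> r \<le>o |S| \<Longrightarrow> \<not> small S"
  unfolding small_iff
  by (meson not_ordLess_ordLeq ordIso_symmetric ordIso_ordLeq_trans)

text \<open>One set of naturals codes a whole sequence of sets, so a stage can carry its own list of
  tasks.\<close>

definition section_at :: "nat set \<Rightarrow> nat \<Rightarrow> nat set" where
  "section_at S n = {k. prod_encode (n, k) \<in> S}"

lemma ex_section_at: "\<exists>S. section_at S = F"
proof
  show "section_at {prod_encode (n, k) | n k. k \<in> F n} = F"
    by (auto simp: section_at_def fun_eq_iff)
qed

section \<open>Stages\<close>

text \<open>The strict part of a cardinal well-order: every stage has fewer than continuum many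
  predecessors.\<close>

definition before :: "nat set rel" where
  "before = |UNIV :: nat set set| - Id"

lemma wf_before: "wf before"
  unfolding before_def using card_of_Well_order well_order_on_def by blast

lemma before_linear: "(i, j) \<in> before \<or> i = j \<or> (j, i) \<in> before"
  unfolding before_def
  using card_of_well_order_on[of "UNIV :: nat set set"]
  by (auto simp: well_order_on_def linear_order_on_def total_on_def)

lemma before_trans: "(i, j) \<in> before \<Longrightarrow> (j, k) \<in> before \<Longrightarrow> (i, k) \<in> before"
  unfolding before_def
  using card_of_well_order_on[of "UNIV :: nat set set"]
  by (auto simp: well_order_on_def linear_order_on_def partial_order_on_def preorder_on_def
      dest: antisymD transD)

lemma small_before: "small {j. (j, i) \<in> before}"
proof -
  have "{j. (j, i) \<in> before} = underS |UNIV :: nat set set| i"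
    by (auto simp: before_def underS_def)
  then show ?thesis
    unfolding small_def using card_of_underS[OF card_of_Card_order, of i]
    by (simp add: Field_card_of)
qed

lemma not_small_unbounded:
  assumes "\<not> small S"
  shows "\<exists>j\<in>S. (i, j) \<in> before"
proof (rule ccontr)
  assume "\<not> ?thesis"
  then have "S \<subseteq> {j. (j, i) \<in> before} \<union> {i}"
    using before_linear by blast
  then show False
    using assms small_subset small_Un small_before small_countable
    by (metis countable_insert countable_empty)
qed

text \<open>Column 1 is free and takes continuum many values, so the codes of a task are too many to
  have no member after \<open>i\<close>.\<close>

lemma ex_task_after:
  "\<exists>j. (i, j) \<in> before \<and> section_at j 0 = Y \<and> (\<forall>n. section_at j (Suc (Suc n)) = b n)"
proof -
  let ?S = "{j. section_at j 0 = Y \<and> (\<forall>n. section_at j (Suc (Suc n)) = b n)}"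
  have "t \<in> (\<lambda>j. section_at j 1) ` ?S" for t
  proof -
    let ?F = "\<lambda>n. case n of 0 \<Rightarrow> Y | Suc 0 \<Rightarrow> t | Suc (Suc m) \<Rightarrow> b m"
    from ex_section_at[of ?F] obtain j where j: "section_at j = ?F" ..
    show ?thesis
    proof (rule image_eqI)
      show "t = section_at j 1" by (simp add: j)
      show "j \<in> ?S" by (simp add: j)
    qed
  qed
  then have "(\<lambda>j. section_at j 1) ` ?S = UNIV" by (rule UNIV_eq_I[symmetric])
  then have "\<not> small ?S"
    using not_small_UNIV small_image[of ?S "\<lambda>j. section_at j 1"] by argo
  from not_small_unbounded[OF this, of i] show ?thesis by auto
qed

section \<open>Consequences of the cardinal equalities\<close>

text \<open>In terms of cardinals: b \<ge> c and s \<ge> c.\<close>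

locale large_b_s =
  assumes small_bounded: "small F \<Longrightarrow> \<exists>g. \<forall>f\<in>F. f <\<^sup>* g"
    and small_not_splitting: "small \<S> \<Longrightarrow> \<not> splitting_family \<S>"
begin

text \<open>Regularity of the continuum, from b \<ge> c. If \<open>K\<close> were cofinal, let
  \<open>g k\<close> bound all functions coded up to \<open>k\<close> and let \<open>h\<close> bound
  all \<open>g k\<close>. Then \<open>h\<close> is itself coded up to some \<open>k\<close> in
  \<open>K\<close>, whence \<open>h <\<^sup>* g k\<close> and
  \<open>g k <\<^sup>* h\<close>.\<close>

lemma small_stages_bounded:
  assumes "small K"
  shows "\<exists>i. \<forall>k\<in>K. (k, i) \<in> before"
proof (rule ccontr)
  assume unbounded: "\<nexists>i. \<forall>k\<in>K. (k, i) \<in> before"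
  \<comment> \<open>The value 0 of \<open>card\<close> on infinite columns is harmless: what matters
    is that every function is some \<open>\<phi> i\<close>.\<close>
  define \<phi> :: "nat set \<Rightarrow> nat \<Rightarrow> nat" where "\<phi> i n = card (section_at i n)" for i n
  have "small (\<phi> ` ({j. (j, k) \<in> before} \<union> {k}))" for k
    by (intro small_image small_Un small_before small_countable) auto
  then have "\<exists>g. \<forall>f \<in> \<phi> ` ({j. (j, k) \<in> before} \<union> {k}). f <\<^sup>* g" for k
    using small_bounded by blast
  then obtain g where g: "\<And>j k. (j, k) \<in> before \<or> j = k \<Longrightarrow> \<phi> j <\<^sup>* g k"
    by simp metis
  obtain h where h: "\<And>k. k \<in> K \<Longrightarrow> g k <\<^sup>* h"
    using small_bounded[OF small_image[OF assms, of g]] by blast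
  obtain i where "section_at i = (\<lambda>n. {..<h n})"
    using ex_section_at[of "\<lambda>n. {..<h n}"] by iprover
  then have i: "\<phi> i = h" by (simp add: \<phi>_def fun_eq_iff)
  obtain k where k: "k \<in> K" "(i, k) \<in> before \<or> i = k"
    using unbounded before_linear by blast
  have "h <\<^sup>* g k" using g[OF k(2)] i by simp
  then have "finite ({n. g k n \<le> h n} \<union> {n. h n \<le> g k n})"
    using h[OF k(1)] by (simp add: eventually_less_def)
  moreover have "{n. g k n \<le> h n} \<union> {n. h n \<le> g k n} = UNIV" by auto
  ultimately show False by simp
qed

text \<open>Pull \<open>\<S>\<close> back along the enumeration of \<open>X\<close>; an infinite set
  of indices split by no preimage has the required image.\<close>

lemma unsplit_subset:
  assumes "small \<S>" "infinite X"
  shows "\<exists>a\<subseteq>X. infinite a \<and> (\<forall>Q\<in>\<S>. a \<subseteq>\<^sup>* Q \<or> finite (a \<inter> Q))"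
proof -
  define e where "e = enumerate X"
  have e: "inj e" "range e = X"
    using bij_enumerate[OF assms(2)] by (auto simp: e_def bij_betw_def)
  have "\<not> splitting_family ((\<lambda>Q. e -` Q) ` \<S>)"
    using assms(1) small_image small_not_splitting by blast
  then obtain Z where Z: "infinite Z"
    "\<And>Q. Q \<in> \<S> \<Longrightarrow> finite (Z - e -` Q) \<or> finite (Z \<inter> e -` Q)"
    unfolding splitting_family_def by blast
  have "e ` Z \<subseteq>\<^sup>* Q \<or> finite (e ` Z \<inter> Q)" if "Q \<in> \<S>" for Q
  proof -
    have "e ` Z - Q = e ` (Z - e -` Q)" "e ` Z \<inter> Q = e ` (Z \<inter> e -` Q)" by auto
    then show ?thesis using Z(2)[OF that] by (auto simp: almost_subset_def)
  qed
  moreover have "infinite (e ` Z)"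
    using Z(1) e(1) finite_imageD inj_on_subset by blast
  moreover have "e ` Z \<subseteq> X" using e(2) by blast
  ultimately show ?thesis by (intro exI[of _ "e ` Z"]) simp
qed

text \<open>Each \<open>d\<close> yields the function sending \<open>n\<close> to the maximum of
  \<open>d \<inter> c n\<close>, and \<open>g\<close> dominates all of these.\<close>

lemma dominating_column_heights:
  fixes c :: "nat \<Rightarrow> nat set"
  assumes "small \<D>" and "\<And>d n. d \<in> \<D> \<Longrightarrow> finite (d \<inter> c n)"
  shows "\<exists>g. \<forall>d\<in>\<D>. finite {n. \<exists>k \<in> d \<inter> c n. g n \<le> k}"
proof -
  \<comment> \<open>The inserted 0 keeps \<open>Max\<close> defined when \<open>d\<close> misses
    \<open>c n\<close>.\<close>
  obtain g where g: "\<And>d. d \<in> \<D> \<Longrightarrow> (\<lambda>n. Max (insert 0 (d \<inter> c n))) <\<^sup>* g"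
    using small_bounded[OF small_image[OF assms(1), of "\<lambda>d n. Max (insert 0 (d \<inter> c n))"]]
    by blast
  have "finite {n. \<exists>k \<in> d \<inter> c n. g n \<le> k}" if "d \<in> \<D>" for d
  proof (rule finite_subset)
    show "{n. \<exists>k \<in> d \<inter> c n. g n \<le> k} \<subseteq> {n. Max (insert 0 (d \<inter> c n)) \<ge> g n}"
      using assms(2)[OF that] Max_ge by (fastforce intro: order_trans)
    show "finite {n. Max (insert 0 (d \<inter> c n)) \<ge> g n}"
      using g[OF that] by (simp add: eventually_less_def)
  qed
  then show ?thesis by blast
qed

lemma ex_separator:
  assumes "small \<A>" and ad: "\<And>a b. a \<in> \<A> \<Longrightarrow> b \<in> \<A> \<Longrightarrow> a \<noteq> b \<Longrightarrow> finite (a \<inter> b)"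
    and "countable \<B>"
  shows "\<exists>X. (\<forall>b\<in>\<A> \<inter> \<B>. b \<subseteq>\<^sup>* X) \<and> (\<forall>a\<in>\<A> - \<B>. finite (a \<inter> X))"
proof (cases "\<A> \<inter> \<B> = {}")
  case True
  then show ?thesis by (intro exI[of _ "{}"]) auto
next
  case False
  define b where "b = from_nat_into (\<A> \<inter> \<B>)"
  have b: "range b = \<A> \<inter> \<B>"
    unfolding b_def using False assms(3) by (intro range_from_nat_into) auto
  have "\<exists>g. \<forall>d\<in>\<A> - \<B>. finite {n. \<exists>k \<in> d \<inter> b n. g n \<le> k}"
  proof (rule dominating_column_heights)
    show "small (\<A> - \<B>)" using assms(1) small_subset by blast
    show "finite (d \<inter> b n)" if "d \<in> \<A> - \<B>" for d n
      using that b by (intro ad) auto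
  qed
  then obtain g where g: "\<And>d. d \<in> \<A> - \<B> \<Longrightarrow> finite {n. \<exists>k \<in> d \<inter> b n. g n \<le> k}"
    by blast
  \<comment> \<open>Each \<open>b n\<close> loses only its part below \<open>g n\<close>; a set
    \<open>d\<close> outside \<open>\<B>\<close> meets these tails for finitely many
    \<open>n\<close>, each time in a finite set.\<close>
  define X where "X = (\<Union>n. b n \<inter> {g n..})"
  have "b n \<subseteq>\<^sup>* X" for n
    unfolding almost_subset_def
    by (rule finite_subset[of _ "{..<g n}"]) (auto simp: X_def)
  moreover have "finite (d \<inter> X)" if "d \<in> \<A> - \<B>" for d
  proof (rule finite_subset)
    show "d \<inter> X \<subseteq> (\<Union>n \<in> {n. \<exists>k \<in> d \<inter> b n. g n \<le> k}. d \<inter> b n)"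
      by (auto simp: X_def)
    have "finite (d \<inter> b n)" for n
      using that b by (intro ad) auto
    then show "finite (\<Union>n \<in> {n. \<exists>k \<in> d \<inter> b n. g n \<le> k}. d \<inter> b n)"
      using g[OF that] by blast
  qed
  ultimately have "(\<forall>d\<in>range b. d \<subseteq>\<^sup>* X) \<and> (\<forall>a\<in>\<A> - \<B>. finite (a \<inter> X))"
    by auto
  then show ?thesis unfolding b by iprover
qed

text \<open>A diagonal choice: one point of \<open>Y\<close> from each of countably many members
  \<open>b n\<close>, taken above \<open>g n\<close> to stay almost disjoint from all other
  members.\<close>

lemma J_plus_almost_disjoint_subset:
  assumes "small \<A>" and ad: "\<And>a b. a \<in> \<A> \<Longrightarrow> b \<in> \<A> \<Longrightarrow> a \<noteq> b \<Longrightarrow> finite (a \<inter> b)"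
    and "Y \<in> J_plus \<A>"
  shows "\<exists>Z\<subseteq>Y. infinite Z \<and> (\<forall>a\<in>\<A>. finite (a \<inter> Z))"
proof -
  obtain b :: "nat \<Rightarrow> nat set" where b: "inj b" "range b \<subseteq> {a \<in> \<A>. infinite (a \<inter> Y)}"
    using assms(3) infinite_countable_subset unfolding J_plus_def by blast
  \<comment> \<open>Removing the earlier \<open>b m\<close> makes the chosen points distinct and
    leaves in \<open>b m\<close> only points of index at most \<open>m\<close>.\<close>
  define c where "c n = b n \<inter> Y - (\<Union>m<n. b m)" for n
  have "infinite (c n)" for n
  proof
    assume "finite (c n)"
    moreover have "finite (\<Union>m<n. b n \<inter> b m)"
      using b by (intro finite_UN_I ad) (auto simp: inj_eq)
    ultimately have "finite (c n \<union> (\<Union>m<n. b n \<inter> b m))" by simp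
    then have "finite (b n \<inter> Y)"
      by (rule rev_finite_subset) (auto simp: c_def)
    then show False using b by blast
  qed
  note inf = this
  have "\<exists>g. \<forall>d\<in>\<A> - range b. finite {n. \<exists>k \<in> d \<inter> b n. g n \<le> k}"
  proof (rule dominating_column_heights)
    show "small (\<A> - range b)" using assms(1) small_subset by blast
    show "finite (d \<inter> b n)" if "d \<in> \<A> - range b" for d n
      using that b by (intro ad) auto
  qed
  then obtain g where g: "\<And>d. d \<in> \<A> - range b \<Longrightarrow> finite {n. \<exists>k \<in> d \<inter> b n. g n \<le> k}"
    by blast
  have "\<exists>y. y \<in> c n \<and> g n \<le> y" for n
    using inf[of n] by (meson finite_nat_set_iff_bounded_le nat_le_linear)
  then obtain y where y: "\<And>n. y n \<in> c n" "\<And>n. g n \<le> y n" by metis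
  have yn: "y n \<in> b n" "y n \<in> Y" "m < n \<Longrightarrow> y n \<notin> b m" for m n
    using y(1)[of n] by (auto simp: c_def)
  have "inj y"
    using yn by (intro injI) (metis linorder_neqE_nat)
  then have "infinite (range y)" by (simp add: range_inj_infinite)
  moreover have "finite (a \<inter> range y)" if "a \<in> \<A>" for a
  proof (cases "a \<in> range b")
    case True
    then obtain m where "a = b m" by blast
    then have "a \<inter> range y \<subseteq> y ` {..m}"
      using yn(3)[of m] by (auto intro!: imageI leI)
    then show ?thesis by (rule finite_subset) simp
  next
    case False
    have "a \<inter> range y \<subseteq> y ` {n. \<exists>k \<in> a \<inter> b n. g n \<le> k}"
      using yn y(2) by blast
    then show ?thesis
      by (rule finite_subset) (use g that False in blast)
  qed
  ultimately show ?thesis using yn(2) by (intro exI[of _ "range y"]) auto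
qed

section \<open>The construction\<close>

text \<open>\<open>a\<close> joins the family and \<open>X\<close> becomes a promise that
  \<open>a\<close> already respects. Of the two alternatives for \<open>Y\<close>, the first serves
  complete separability, the second maximality.\<close>

definition extension_step ::
    "nat set set \<Rightarrow> nat set set \<Rightarrow> nat set \<Rightarrow> nat set set \<Rightarrow> nat set \<times> nat set \<Rightarrow> bool" where
  "extension_step \<A> \<P> Y \<B> = (\<lambda>(a, X).
     infinite a \<and> (\<forall>b\<in>\<A>. finite (a \<inter> b)) \<and>
     (\<forall>Q\<in>insert X \<P>. a \<subseteq>\<^sup>* Q \<or> finite (a \<inter> Q)) \<and>
     (Y \<in> J_plus \<A> \<or> infinite Y \<and> (\<forall>b\<in>\<A>. finite (b \<inter> Y)) \<longrightarrow> a \<subseteq> Y) \<and>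
     (\<forall>b\<in>\<A> \<inter> \<B>. b \<subseteq>\<^sup>* X) \<and> (\<forall>b\<in>\<A> - \<B>. finite (b \<inter> X)))"

lemma ex_extension_step:
  assumes "small \<A>" "small \<P>" "almost_disjoint_family \<A>" "countable \<B>"
  shows "\<exists>p. extension_step \<A> \<P> Y \<B> p"
proof -
  have ad: "\<And>a b. a \<in> \<A> \<Longrightarrow> b \<in> \<A> \<Longrightarrow> a \<noteq> b \<Longrightarrow> finite (a \<inter> b)"
    and infinite: "infinite \<A>" "\<And>a. a \<in> \<A> \<Longrightarrow> infinite a"
    using assms(3) by (auto simp: almost_disjoint_family_def)
  obtain X where X: "\<forall>b\<in>\<A> \<inter> \<B>. b \<subseteq>\<^sup>* X" "\<forall>a\<in>\<A> - \<B>. finite (a \<inter> X)"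
    using ex_separator[OF assms(1) ad assms(4)] by blast
  let ?good = "Y \<in> J_plus \<A> \<or> infinite Y \<and> (\<forall>b\<in>\<A>. finite (b \<inter> Y))"
  \<comment> \<open>\<open>UNIV\<close> replaces \<open>Y\<close> when neither alternative holds; in
    the second alternative \<open>Z\<close> can be \<open>Y\<close> itself.\<close>
  have "{a \<in> \<A>. infinite (a \<inter> UNIV)} = \<A>"
    using infinite(2) by auto
  then have "UNIV \<in> J_plus \<A>"
    using infinite(1) by (simp add: J_plus_def)
  then have "\<exists>Z. infinite Z \<and> (\<forall>a\<in>\<A>. finite (a \<inter> Z)) \<and> (?good \<longrightarrow> Z \<subseteq> Y)"
    using J_plus_almost_disjoint_subset[OF assms(1) ad] by (metis order_refl)
  then obtain Z where Z: "infinite Z" "\<And>a. a \<in> \<A> \<Longrightarrow> finite (a \<inter> Z)" "?good \<longrightarrow> Z \<subseteq> Y"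
    by blast
  have "small (insert X \<P>)"
    using small_Un[OF small_countable[of "{X}"] assms(2)] by simp
  then obtain a where a: "a \<subseteq> Z" "infinite a"
    "\<forall>Q\<in>insert X \<P>. a \<subseteq>\<^sup>* Q \<or> finite (a \<inter> Q)"
    using unsplit_subset Z(1) by metis
  have "finite (a \<inter> b)" if "b \<in> \<A>" for b
    using Z(2)[OF that] by (rule rev_finite_subset) (use a(1) in auto)
  then have "extension_step \<A> \<P> Y \<B> (a, X)"
    using a Z(3) X by (auto simp: extension_step_def)
  then show ?thesis by blast
qed

definition family_at :: "nat set set \<Rightarrow> (nat set \<Rightarrow> nat set \<times> nat set) \<Rightarrow> nat set \<Rightarrow> nat set set"
  where "family_at \<A> f i = \<A> \<union> (fst \<circ> f) ` {j. (j, i) \<in> before}"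

definition promises_at :: "(nat set \<Rightarrow> nat set \<times> nat set) \<Rightarrow> nat set \<Rightarrow> nat set set"
  where "promises_at f i = (snd \<circ> f) ` {j. (j, i) \<in> before}"

text \<open>
  The tasks of stage \<open>i\<close> are coded by the columns of \<open>i\<close>: column \<open>0\<close> is \<open>Y\<close>, columns \<open>2, 3, \<dots>\<close>
  list \<open>\<B>\<close>, and column \<open>1\<close> is a dummy that makes every task recur cofinally often.
\<close>

definition stage_step ::
    "nat set set \<Rightarrow> (nat set \<Rightarrow> nat set \<times> nat set) \<Rightarrow> nat set \<Rightarrow> nat set \<times> nat set \<Rightarrow> bool" where
  "stage_step \<A> f i = extension_step (family_at \<A> f i) (promises_at f i)
     (section_at i 0) (range (\<lambda>n. section_at i (Suc (Suc n))))"

text \<open>Of two added sets, the later one was chosen almost disjoint from the earlier. The set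
  \<open>K\<close> covers both initial segments, during the recursion, and all stages at the
  end.\<close>

lemma almost_disjoint_family_stages:
  assumes "almost_disjoint_family \<A>" and step: "\<And>j. j \<in> K \<Longrightarrow> stage_step \<A> f j (f j)"
  shows "almost_disjoint_family (\<A> \<union> (fst \<circ> f) ` K)"
proof -
  have inf: "infinite (fst (f j))" if "j \<in> K" for j
    using step[OF that] by (auto simp: stage_step_def extension_step_def)
  have new: "finite (fst (f j) \<inter> b)" if "j \<in> K" "b \<in> family_at \<A> f j" for j b
    using step[OF that(1)] that(2) by (auto simp: stage_step_def extension_step_def)
  have old: "finite (fst (f j) \<inter> b)" "finite (b \<inter> fst (f j))" if "j \<in> K" "b \<in> \<A>" for j b
    using new[OF that(1), of b] that(2) by (auto simp: family_at_def Int_commute)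
  have "finite (fst (f j) \<inter> fst (f k))" if "j \<in> K" "k \<in> K" "(k, j) \<in> before" for j k
    using new[OF that(1), of "fst (f k)"] that(3) by (auto simp: family_at_def)
  then have "finite (fst (f j) \<inter> fst (f k))" if "j \<in> K" "k \<in> K" "j \<noteq> k" for j k
    using before_linear[of j k] that by (metis Int_commute)
  then show ?thesis
    using assms(1) inf old unfolding almost_disjoint_family_def by auto
qed

text \<open>Well-founded choice applies because the requirement at \<open>i\<close> reads
  \<open>f\<close> only below \<open>i\<close>, where the family and the promises are still
  small.\<close>

lemma ex_stages:
  assumes "almost_disjoint_family \<A>" "small \<A>"
  shows "\<exists>f. \<forall>i. stage_step \<A> f i (f i)"
proof (rule dependent_wf_choice[OF wf_before])
  fix f g :: "nat set \<Rightarrow> nat set \<times> nat set" and i p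
  assume "\<And>j. (j, i) \<in> before \<Longrightarrow> f j = g j"
  then have "family_at \<A> f i = family_at \<A> g i" "promises_at f i = promises_at g i"
    by (auto simp: family_at_def promises_at_def)
  then show "stage_step \<A> f i p = stage_step \<A> g i p"
    by (simp add: stage_step_def)
next
  fix i and f :: "nat set \<Rightarrow> nat set \<times> nat set"
  assume "\<And>j. (j, i) \<in> before \<Longrightarrow> stage_step \<A> f j (f j)"
  then have "almost_disjoint_family (family_at \<A> f i)"
    unfolding family_at_def using assms(1) by (intro almost_disjoint_family_stages) auto
  moreover have "small (family_at \<A> f i)" "small (promises_at f i)"
    unfolding family_at_def promises_at_def
    using assms(2) by (intro small_Un small_image small_before; simp)+
  ultimately show "\<exists>p. stage_step \<A> f i p"
    unfolding stage_step_def by (intro ex_extension_step) auto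
qed

text \<open>Each member of \<open>\<C>\<close> is present after some stage; by regularity these
  stages have a common bound.\<close>

lemma small_subset_family_at:
  assumes "small \<C>" "\<C> \<subseteq> \<A> \<union> range (fst \<circ> f)"
  shows "\<exists>i. \<forall>j. (i, j) \<in> before \<longrightarrow> \<C> \<subseteq> family_at \<A> f j"
proof -
  have "\<exists>k. \<forall>j. (k, j) \<in> before \<longrightarrow> c \<in> family_at \<A> f j" if "c \<in> \<C>" for c
  proof -
    have "c \<in> \<A> \<or> (\<exists>k. c = fst (f k))" using assms(2) that by auto
    then show ?thesis by (auto simp: family_at_def)
  qed
  then obtain k where k: "\<And>c j. c \<in> \<C> \<Longrightarrow> (k c, j) \<in> before \<Longrightarrow> c \<in> family_at \<A> f j"
    by metis
  obtain i where i: "\<And>c. c \<in> \<C> \<Longrightarrow> (k c, i) \<in> before"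
    using small_stages_bounded[OF small_image[OF assms(1), of k]] by blast
  show ?thesis
    using k i before_trans by blast
qed

lemma ex_good_mad_family:
  assumes "almost_disjoint_family \<A>" "small \<A>"
  shows "\<exists>\<M>. mad_family \<M> \<and> \<A> \<subseteq> \<M> \<and> completely_separable \<M> \<and> strongly_separated \<M>"
proof -
  obtain f where f: "\<And>i. stage_step \<A> f i (f i)"
    using ex_stages[OF assms] by blast
  define \<M> where "\<M> = \<A> \<union> range (fst \<circ> f)"
  have family_sub: "family_at \<A> f i \<subseteq> \<M>" for i
    by (auto simp: family_at_def \<M>_def)
  have hit: "fst (f i) \<subseteq> section_at i 0"
    if "section_at i 0 \<in> J_plus (family_at \<A> f i) \<or>
      infinite (section_at i 0) \<and> (\<forall>b\<in>family_at \<A> f i. finite (b \<inter> section_at i 0))" for i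
    using f[of i] that by (auto simp: stage_step_def extension_step_def split_beta)
  have ad: "almost_disjoint_family \<M>"
    unfolding \<M>_def using assms(1) f by (intro almost_disjoint_family_stages) auto
  have "mad_family \<M>"
    unfolding mad_family_def
  proof (intro conjI ad notI)
    assume "\<exists>\<B>. almost_disjoint_family \<B> \<and> \<M> \<subset> \<B>"
    then obtain \<B> Y where "almost_disjoint_family \<B>" "\<M> \<subseteq> \<B>" "Y \<in> \<B>" and "Y \<notin> \<M>"
      by blast
    then have Y: "infinite Y" "\<And>a. a \<in> \<M> \<Longrightarrow> finite (a \<inter> Y)"
      unfolding almost_disjoint_family_def by (metis subsetD)+
    \<comment> \<open>Any stage with task \<open>Y\<close> will do, since \<open>Y\<close> is almost
      disjoint from all of \<open>\<M>\<close>; it adds an infinite subset of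
      \<open>Y\<close>.\<close>
    obtain i where i: "section_at i 0 = Y"
      using ex_section_at[of "\<lambda>_. Y"] by metis
    have "\<forall>b\<in>family_at \<A> f i. finite (b \<inter> Y)"
      using Y(2) family_sub[of i] by auto
    then have "fst (f i) \<inter> Y = fst (f i)"
      using hit[of i] Y(1) unfolding i by auto
    moreover have "fst (f i) \<in> \<M>" by (simp add: \<M>_def)
    ultimately show False
      using Y(2)[of "fst (f i)"] ad by (simp add: almost_disjoint_family_def)
  qed
  moreover have "completely_separable \<M>"
    unfolding completely_separable_def
  proof
    fix Y assume "Y \<in> J_plus \<M>"
    then obtain b :: "nat \<Rightarrow> nat set" where
      b: "inj b" "range b \<subseteq> {a \<in> \<M>. infinite (a \<inter> Y)}"
      using infinite_countable_subset unfolding J_plus_def by blast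
    \<comment> \<open>Infinitely many witnesses are present from some stage on, so \<open>Y\<close>
      is already in \<open>J_plus\<close> of the family at a later stage with task
      \<open>Y\<close>.\<close>
    then obtain i where i: "\<And>j. (i, j) \<in> before \<Longrightarrow> range b \<subseteq> family_at \<A> f j"
      using small_subset_family_at[of "range b" \<A> f] small_countable[of "range b"]
      unfolding \<M>_def by auto
    obtain j where j: "(i, j) \<in> before" "section_at j 0 = Y"
      using ex_task_after by metis
    have "range b \<subseteq> {a \<in> family_at \<A> f j. infinite (a \<inter> Y)}"
      using i[OF j(1)] b(2) by blast
    then have "Y \<in> J_plus (family_at \<A> f j)"
      unfolding J_plus_def using range_inj_infinite[OF b(1)] finite_subset by blast
    then have "fst (f j) \<subseteq> Y" using hit[of j] j(2) by blast
    then show "\<exists>a\<in>\<M>. a \<subseteq> Y" by (auto simp: \<M>_def)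
  qed
  moreover have "strongly_separated \<M>"
    unfolding strongly_separated_def
  proof (intro allI impI, elim conjE)
    fix \<B> \<C> assume sub: "\<B> \<subseteq> \<M>" "\<C> \<subseteq> \<M>" and disj: "\<B> \<inter> \<C> = {}"
      and count: "countable \<B>" and "|\<C>| <o continuum"
    show "\<exists>X. partitioner_for \<M> \<B> \<C> X"
    \<comment> \<open>A listing by \<open>from_nat_into\<close> has range \<open>\<B>\<close> only
      for nonempty \<open>\<B>\<close>.\<close>
    proof (cases "\<B> = {}")
      case True
      then show ?thesis
        by (intro exI[of _ "{}"]) (simp add: partitioner_for_def partitioner_def)
    next
      case False
      have "small (\<B> \<union> \<C>)"
        using \<open>|\<C>| <o continuum\<close> count small_iff small_Un small_countable by blast
      then obtain i where i: "\<And>j. (i, j) \<in> before \<Longrightarrow> \<B> \<union> \<C> \<subseteq> family_at \<A> f j"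
        using small_subset_family_at[of "\<B> \<union> \<C>" \<A> f] sub unfolding \<M>_def by auto
      obtain j where j: "(i, j) \<in> before"
        "\<And>n. section_at j (Suc (Suc n)) = from_nat_into \<B> n"
        using ex_task_after by metis
      then have \<B>: "range (\<lambda>n. section_at j (Suc (Suc n))) = \<B>"
        using False count by simp
      \<comment> \<open>This promise separates \<open>\<B>\<close> from the whole rest of the family
        at \<open>j\<close>, which includes \<open>\<C>\<close>.\<close>
      define X where "X = snd (f j)"
      have X: "\<And>b. b \<in> family_at \<A> f j \<Longrightarrow> b \<in> \<B> \<Longrightarrow> b \<subseteq>\<^sup>* X"
        "\<And>c. c \<in> family_at \<A> f j \<Longrightarrow> c \<notin> \<B> \<Longrightarrow> finite (c \<inter> X)"
        "fst (f j) \<subseteq>\<^sup>* X \<or> finite (fst (f j) \<inter> X)"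
        using f[of j] by (auto simp: stage_step_def extension_step_def \<B> X_def split_beta)
      have later: "fst (f k) \<subseteq>\<^sup>* X \<or> finite (fst (f k) \<inter> X)" if "(j, k) \<in> before" for k
      proof -
        have "X \<in> promises_at f k" using that by (auto simp: promises_at_def X_def)
        then show ?thesis
          using f[of k] by (auto simp: stage_step_def extension_step_def split_beta)
      qed
      \<comment> \<open>Earlier members are decided by separation, the set added at \<open>j\<close>
        by its own choice, and later ones by the promise.\<close>
      have "a \<subseteq>\<^sup>* X \<or> finite (a \<inter> X)" if a: "a \<in> \<M>" for a
      proof (cases "a \<in> family_at \<A> f j")
        case True
        then show ?thesis using X(1,2) by blast
      next
        case False
        obtain k where k: "a = fst (f k)"
          using False a by (auto simp: \<M>_def family_at_def)
        then have "(k, j) \<notin> before"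
          using False by (auto simp: family_at_def)
        then show ?thesis using later X(3) before_linear[of j k] k by auto
      qed
      then have "partitioner_for \<M> \<B> \<C> X"
        unfolding partitioner_for_def partitioner_def
        using X(1,2) i[OF j(1)] disj by (metis UnI1 UnI2 disjoint_iff subsetD)
      then show ?thesis by iprover
    qed
  qed
  ultimately show ?thesis by (intro exI[of _ \<M>]) (simp add: \<M>_def)
qed

end

theorem theorem6p4:
  assumes "bounding_number =o continuum" and "splitting_number =o continuum"
  shows "mad_exist_generically (\<lambda>\<A>. completely_separable \<A> \<and> strongly_separated \<A>)"
proof -
  \<comment> \<open>A small unbounded or splitting family would put b or s below c.\<close>
  interpret large_b_s
  proof
    show "\<exists>g. \<forall>h\<in>F. h <\<^sup>* g" if "small F" for F
    proof -
      have "\<not> unbounded_family F"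
        using not_small_if_continuum_le[OF assms(1)] that
          least_card(2)[of unbounded_family, OF unbounded_family_UNIV]
        unfolding bounding_number_def by metis
      then show ?thesis by (simp add: unbounded_family_def)
    qed
    show "\<not> splitting_family \<S>" if "small \<S>" for \<S>
      using not_small_if_continuum_le[OF assms(2)] that
        least_card(2)[of splitting_family, OF splitting_family_UNIV]
      unfolding splitting_number_def by metis
  qed
  show ?thesis
    unfolding mad_exist_generically_def small_iff[symmetric]
    using ex_good_mad_family by simp
qed

end
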